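(* Let $q=p^e$ be a prime power, $\ell$ an odd prime with $\ell\neq p$, and $n$ a positive integer divisible by neither $p$ nor $\ell$. Let $\gamma\in\mathbb{Z}$, let $c_n(\gamma)$ be the $q$-cyclotomic coset modulo $n$ containing $\gamma$, and let $\tau=|c_n(\gamma)|$. Assume that $\ell\mid q^\tau-1$, and put $v=v_\ell(q^\tau-1)$. Then: (1) The sequence $$\mathfrak{c}_\infty(\gamma)=\bigl(c_{\ell^i n}(\gamma+n\cdot\varphi(\gamma)_{\leq i-1})\bigr)_{i\in\mathbb{N}}$$ is an element of $\mathcal{PC}_n^\ell(\gamma)$, and it is the unique element of $\mathcal{PC}_n^\ell(\gamma)$ that is splitting (i.e. splitting at every degree $i\in\mathbb{N}$). (2) For every $m\in\mathbb{N}$ and $a\in[1,\ell-1]$, the integer $U(\gamma;m,a)$ gives rise to $\ell^{v-1}$ elements $$\mathfrak{c}_{m,a,t}(\gamma)=\bigl(c_{\ell^i n}(\gamma+n(U(\gamma;m,a)+\ell^{m+1}t))\bigr)_{i\in\mathbb{N}}\in\mathcal{PC}_n^\ell(\gamma),\qquad t\in[0,\ell^{v-1}-1].$$ Furthermore, the sequences $\mathfrak{c}_\infty(\gamma)$ and $\mathfrak{c}_{m,a,t}(\gamma)$ ($m\in\mathbb{N}$, $a\in[1,\ell-1]$, $t\in[0,\ell^{v-1}-1]$) give all elements of $\mathcal{PC}_n^\ell(\gamma)$, without repetition.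
   Context: Notation: $\mathbb{N}=\{0,1,2,\dots\}$; $[a,b]$ is the set of integers from $a$ to $b$; $v_\ell$ is the $\ell$-adic valuation ($v_\ell(0)=\infty$). Cyclotomic cosets. For $M\geq1$ coprime to $q$ and $\gamma\in\mathbb{Z}$, the $q$-cyclotomic coset modulo $M$ containing $\gamma$ is $c_M(\gamma)=\{\gamma,\gamma q,\dots,\gamma q^{\tau-1}\}\subseteq\mathbb{Z}/M\mathbb{Z}$, where $\tau$ is the least positive integer with $\gamma q^\tau\equiv\gamma\pmod M$; its size is $|c_M(\gamma)|=\tau$. Cyclotomic system. $\mathcal{PC}_n^\ell(\gamma)$ is the set of sequences $(C_i)_{i\in\mathbb{N}}$ with $C_i$ a $q$-cyclotomic coset modulo $\ell^i n$, $C_0=c_n(\gamma)$, and such that for all $i_1\geq i_2$ the canonical projection $\mathbb{Z}/\ell^{i_1}n\mathbb{Z}\to\mathbb{Z}/\ell^{i_2}n\mathbb{Z}$ maps $C_{i_1}$ onto $C_{i_2}$. Splitting. A coset $c_M(\delta)$ of size $\tau'$ with $\ell\mid q^{\tau'}-1$ is splitting (with respect to $\mathbb{Z}/\ell M\mathbb{Z}:\mathbb{Z}/M\mathbb{Z}$) if $v_\ell(\delta)+v_\ell(q^{\tau'}-1)\geq v_\ell(M)+1$ for some (equivalently every) integer representative $\delta$ of $\delta+M\mathbb{Z}$. A sequence $(C_i)_i$ is splitting at degree $i$ if $C_i$ is splitting (with $M=\ell^i n$). Cyclotomic $\ell$-adic integer. $\varphi(\gamma)=-\gamma/n\in\mathbb{Z}_\ell$,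 with $\ell$-adic expansion $\varphi(\gamma)=\sum_{k\geq0}\phi_k\ell^k$, $\phi_k\in[0,\ell-1]$. For $i\geq0$, $\varphi(\gamma)_{\leq i}=\sum_{k=0}^i\phi_k\ell^k$, and $\varphi(\gamma)_{\leq-1}=0$. The integers $U(\gamma;m,a)$. For $m\in\mathbb{N}$ write $[0,\ell-1]\setminus\{\phi_m\}=\{\sigma_1^m<\cdots<\sigma_{\ell-1}^m\}$, and for $a\in[1,\ell-1]$ put $U(\gamma;m,a)=\sum_{k=0}^{m-1}\phi_k\ell^k+\sigma_a^m\ell^m$. *)

theory Defs
  imports "HOL-Algebra.Ring" "HOL-Number_Theory.Cong" "HOL-Library.Extended_Nat"
begin

definition ladic_val :: "nat \<Rightarrow> int \<Rightarrow> enat" where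
  "ladic_val l x = (if x = 0 then \<infinity> else enat (multiplicity (int l) x))"

text \<open>The residue ring of the integers modulo \<open>M\<close> is represented by \<open>{0..<int M}\<close>; the canonical
  projection to a divisor \<open>M'\<close> of \<open>M\<close> is then \<open>\<lambda>x. x mod int M'\<close>.\<close>

definition coset_period :: "nat \<Rightarrow> nat \<Rightarrow> int \<Rightarrow> nat" where
  "coset_period q M \<gamma> = (LEAST t. 0 < t \<and> [\<gamma> * int q ^ t = \<gamma>] (mod int M))"

definition cyc_coset :: "nat \<Rightarrow> nat \<Rightarrow> int \<Rightarrow> int set" where
  "cyc_coset q M \<gamma> = (\<lambda>j. (\<gamma> * int q ^ j) mod int M) ` {..<coset_period q M \<gamma>}"

definition cyc_system :: "nat \<Rightarrow> nat \<Rightarrow> nat \<Rightarrow> int \<Rightarrow> (nat \<Rightarrow> int set) set" where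
  "cyc_system q l n \<gamma> = {C.
     (\<forall>i. \<exists>\<delta>. C i = cyc_coset q (l ^ i * n) \<delta>) \<and>
     C 0 = cyc_coset q n \<gamma> \<and>
     (\<forall>i1 i2. i2 \<le> i1 \<longrightarrow> (\<lambda>x. x mod int (l ^ i2 * n)) ` C i1 = C i2)}"

definition splitting_coset :: "nat \<Rightarrow> nat \<Rightarrow> nat \<Rightarrow> int set \<Rightarrow> bool" where
  "splitting_coset q l M C \<longleftrightarrow>
     int l dvd int q ^ card C - 1 \<and>
     (\<exists>\<delta>. C = cyc_coset q M \<delta> \<and>
        ladic_val l \<delta> + ladic_val l (int q ^ card C - 1) \<ge> ladic_val l (int M) + 1)"

definition splitting_at :: "nat \<Rightarrow> nat \<Rightarrow> nat \<Rightarrow> (nat \<Rightarrow> int set) \<Rightarrow> nat \<Rightarrow> bool" where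
  "splitting_at q l n C i \<longleftrightarrow> splitting_coset q l (l ^ i * n) (C i)"

definition splitting_seq :: "nat \<Rightarrow> nat \<Rightarrow> nat \<Rightarrow> (nat \<Rightarrow> int set) \<Rightarrow> bool" where
  "splitting_seq q l n C \<longleftrightarrow> (\<forall>i. splitting_at q l n C i)"

text \<open>The inverse limit of the residue rings modulo \<open>l ^ i\<close>. The case \<open>i = j\<close> of the carrier condition
  says that every component is a reduced residue.\<close>

definition ladic_ring :: "nat \<Rightarrow> (nat \<Rightarrow> int) ring" where
  "ladic_ring l = \<lparr>
     carrier = {x. \<forall>i j. i \<le> j \<longrightarrow> x j mod int l ^ i = x i},
     monoid.mult = (\<lambda>x y i. (x i * y i) mod int l ^ i),
     one = (\<lambda>i. 1 mod int l ^ i),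
     ring.zero = (\<lambda>i. 0),
     add = (\<lambda>x y i. (x i + y i) mod int l ^ i)\<rparr>"

definition ladic_of_int :: "nat \<Rightarrow> int \<Rightarrow> nat \<Rightarrow> int" where
  "ladic_of_int l x = (\<lambda>i. x mod int l ^ i)"

text \<open>\<open>x = (\<Sum>k. d k * l ^ k)\<close> with digits \<open>d k\<close> in \<open>{0..<l}\<close>: the partial sums converge to \<open>x\<close>
  in the inverse limit topology, i.e. each component is eventually constant with the right value.\<close>

definition ladic_expansion :: "nat \<Rightarrow> (nat \<Rightarrow> int) \<Rightarrow> (nat \<Rightarrow> int) \<Rightarrow> bool" where
  "ladic_expansion l x d \<longleftrightarrow>
     (\<forall>k. d k \<in> {0..<int l}) \<and>
     (\<forall>i. \<forall>\<^sub>F K in sequentially. ladic_of_int l (\<Sum>k<K. d k * int l ^ k) i = x i)"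

definition ladic_digit :: "nat \<Rightarrow> (nat \<Rightarrow> int) \<Rightarrow> nat \<Rightarrow> int" where
  "ladic_digit l x = (THE d. ladic_expansion l x d)"

lemma ladic_of_int_closed: "ladic_of_int l x \<in> carrier (ladic_ring l)"
  by (auto simp: ladic_ring_def ladic_of_int_def mod_mod_cancel le_imp_power_dvd)

lemma ladic_ring_cring: "cring (ladic_ring l)"
proof (rule cringI)
  show "abelian_group (ladic_ring l)"
  proof (rule abelian_groupI)
    fix x assume x: "x \<in> carrier (ladic_ring l)"
    show "\<exists>y\<in>carrier (ladic_ring l). y \<oplus>\<^bsub>ladic_ring l\<^esub> x = \<zero>\<^bsub>ladic_ring l\<^esub>"
    proof (rule bexI)
      show "(\<lambda>i. (- x i) mod int l ^ i) \<in> carrier (ladic_ring l)"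
      proof -
        have "(- x j mod int l ^ j) mod int l ^ i = - x i mod int l ^ i" if "i \<le> j" for i j
        proof -
          have "(- x j mod int l ^ j) mod int l ^ i = (- x j) mod int l ^ i"
            using that by (simp add: mod_mod_cancel le_imp_power_dvd)
          also have "\<dots> = (- (x j mod int l ^ i)) mod int l ^ i" by (simp add: mod_minus_eq)
          finally show ?thesis using x that by (simp add: ladic_ring_def)
        qed
        then show ?thesis by (simp add: ladic_ring_def)
      qed
    qed (auto simp: ladic_ring_def mod_add_left_eq)
  next
    fix x y assume "x \<in> carrier (ladic_ring l)" "y \<in> carrier (ladic_ring l)"
    then show "x \<oplus>\<^bsub>ladic_ring l\<^esub> y \<in> carrier (ladic_ring l)"
      by (auto simp: ladic_ring_def mod_mod_cancel le_imp_power_dvd)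
        (metis mod_add_eq)
  next
    fix x y z
    assume "x \<in> carrier (ladic_ring l)" "y \<in> carrier (ladic_ring l)" "z \<in> carrier (ladic_ring l)"
    then show "x \<oplus>\<^bsub>ladic_ring l\<^esub> y \<oplus>\<^bsub>ladic_ring l\<^esub> z = x \<oplus>\<^bsub>ladic_ring l\<^esub> (y \<oplus>\<^bsub>ladic_ring l\<^esub> z)"
      by (simp add: ladic_ring_def mod_add_left_eq mod_add_right_eq add.assoc)
  qed (auto simp: ladic_ring_def add.commute)
  show "Group.comm_monoid (ladic_ring l)"
  proof (rule comm_monoidI)
    fix x y assume "x \<in> carrier (ladic_ring l)" "y \<in> carrier (ladic_ring l)"
    then show "x \<otimes>\<^bsub>ladic_ring l\<^esub> y \<in> carrier (ladic_ring l)"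
      by (auto simp: ladic_ring_def mod_mod_cancel le_imp_power_dvd)
        (metis mod_mult_eq)
  next
    show "\<one>\<^bsub>ladic_ring l\<^esub> \<in> carrier (ladic_ring l)"
      using ladic_of_int_closed[of l 1] by (simp add: ladic_ring_def ladic_of_int_def)
  next
    fix x assume "x \<in> carrier (ladic_ring l)"
    then show "\<one>\<^bsub>ladic_ring l\<^esub> \<otimes>\<^bsub>ladic_ring l\<^esub> x = x"
      by (auto simp: ladic_ring_def mod_simps)
  qed (auto simp: ladic_ring_def mod_mult_left_eq mod_mult_right_eq mult_ac)
qed (auto simp: ladic_ring_def mod_mult_left_eq mod_add_eq distrib_right)

lemma ladic_of_int_Unit:
  assumes "coprime x (int l)" and "l > 0"
  shows "ladic_of_int l x \<in> Units (ladic_ring l)"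
proof -
  have "\<exists>y. 0 \<le> y \<and> y < int l ^ i \<and> [x * y = 1] (mod int l ^ i)" for i
  proof -
    obtain y where y: "[x * y = 1] (mod int l ^ i)"
      using cong_solve_coprime_int[of x "int l ^ i"] assms by auto
    have "[x * (y mod int l ^ i) = 1] (mod int l ^ i)"
      using y by (simp add: cong_def mod_simps)
    then show ?thesis using assms by (intro exI[of _ "y mod int l ^ i"]) auto
  qed
  then obtain y where y: "\<And>i. 0 \<le> y i" "\<And>i. y i < int l ^ i" "\<And>i. [x * y i = 1] (mod int l ^ i)"
    by metis
  have "y j mod int l ^ i = y i" if "i \<le> j" for i j
  proof -
    have "[x * y j = 1] (mod int l ^ i)"
      using y(3) that le_imp_power_dvd cong_dvd_modulus by blast
    then have "[x * y j = x * y i] (mod int l ^ i)"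
      using y(3) cong_sym cong_trans by blast
    then have "[y j = y i] (mod int l ^ i)"
      using assms by (simp add: cong_mult_lcancel)
    then show ?thesis using y by (simp add: cong_def)
  qed
  then have cl: "y \<in> carrier (ladic_ring l)" by (simp add: ladic_ring_def)
  have "ladic_of_int l x \<otimes>\<^bsub>ladic_ring l\<^esub> y = \<one>\<^bsub>ladic_ring l\<^esub>"
    using y(3) by (auto simp: ladic_ring_def ladic_of_int_def cong_def mod_simps)
  moreover have "y \<otimes>\<^bsub>ladic_ring l\<^esub> ladic_of_int l x = \<one>\<^bsub>ladic_ring l\<^esub>"
    using y(3) by (auto simp: ladic_ring_def ladic_of_int_def cong_def mod_simps mult.commute)
  ultimately show ?thesis
    using cl ladic_of_int_closed[of l x] by (auto simp: Units_def)
qed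

lemma ladic_expansion_ex1:
  assumes "l \<ge> 2" and x: "x \<in> carrier (ladic_ring l)"
  shows "\<exists>!d. ladic_expansion l x d"
proof -
  have xm: "x j mod int l ^ i = x i" if "i \<le> j" for i j
    using x that by (simp add: ladic_ring_def)
  have xb: "0 \<le> x i" "x i < int l ^ i" for i
    using xm[of i i] assms(1) by (metis le_refl pos_mod_sign pos_mod_bound of_nat_0_less_iff
        zero_less_power not_numeral_le_zero gr0I)+
  define d0 where "d0 k = x (Suc k) div int l ^ k" for k
  have s0: "(\<Sum>k<K. d0 k * int l ^ k) = x K" for K
  proof (induction K)
    case 0 then show ?case using xb[of 0] by simp
  next
    case (Suc K)
    then show ?case using xm[of K "Suc K"] by (simp add: d0_def) (metis div_mult_mod_eq add.commute)
  qed
  have "ladic_expansion l x d0"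
    unfolding ladic_expansion_def
  proof (intro conjI allI)
    fix k
    have "int l ^ k * (x (Suc k) div int l ^ k) \<le> x (Suc k)"
      using assms(1) by (simp add: minus_mod_eq_mult_div [symmetric])
    also have "\<dots> < int l ^ k * int l" using xb[of "Suc k"] by (simp add: mult.commute)
    finally have "x (Suc k) div int l ^ k < int l"
      by (simp add: mult_less_cancel_left)
    then show "d0 k \<in> {0..<int l}"
      using xb[of "Suc k"] assms(1) by (simp add: d0_def div_int_pos_iff)
  next
    fix i
    show "\<forall>\<^sub>F K in sequentially. ladic_of_int l (\<Sum>k<K. d0 k * int l ^ k) i = x i"
      using xm by (auto simp: s0 ladic_of_int_def eventually_sequentially)
  qed
  moreover have "d = d0" if d: "ladic_expansion l x d" for d
  proof -
    have db: "0 \<le> d k" "d k < int l" for k using d by (auto simp: ladic_expansion_def)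
    define s where "s K = (\<Sum>k<K. d k * int l ^ k)" for K
    have sb: "0 \<le> s K \<and> s K < int l ^ K" for K
    proof (induction K)
      case 0 then show ?case by (simp add: s_def)
    next
      case (Suc K)
      have "d K * int l ^ K \<le> (int l - 1) * int l ^ K"
        using db[of K] by (intro mult_right_mono) auto
      then show ?case using Suc db[of K] by (simp add: s_def algebra_simps)
    qed
    have sm: "s (i + m) mod int l ^ i = s i" for i m
    proof (induction m)
      case 0 then show ?case using sb by simp
    next
      case (Suc m)
      have "s (i + Suc m) = s (i + m) + int l ^ i * (d (i + m) * int l ^ m)"
        by (simp add: s_def power_add mult_ac)
      then show ?case using Suc by simp
    qed
    have sx: "s i = x i" for i
    proof -
      obtain N where "\<And>K. K \<ge> N \<Longrightarrow> s K mod int l ^ i = x i"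
        using d unfolding ladic_expansion_def ladic_of_int_def eventually_sequentially s_def by blast
      from this[of "i + N"] show ?thesis using sm by simp
    qed
    show "d = d0"
    proof
      fix k
      have "s (Suc k) = s k + d k * int l ^ k" by (simp add: s_def)
      moreover have "x (Suc k) = x k + d0 k * int l ^ k" by (simp flip: s0)
      ultimately show "d k = d0 k" using sx assms(1) by simp
    qed
  qed
  ultimately show ?thesis by blast
qed

definition cyc_ladic :: "nat \<Rightarrow> nat \<Rightarrow> int \<Rightarrow> (nat \<Rightarrow> int)" where
  "cyc_ladic l n \<gamma> =
     ladic_of_int l (- \<gamma>) \<otimes>\<^bsub>ladic_ring l\<^esub> inv\<^bsub>ladic_ring l\<^esub> (ladic_of_int l (int n))"

definition cyc_digit :: "nat \<Rightarrow> nat \<Rightarrow> int \<Rightarrow> nat \<Rightarrow> int" where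
  "cyc_digit l n \<gamma> = ladic_digit l (cyc_ladic l n \<gamma>)"

text \<open>The sum of the terms of the expansion with index strictly below \<open>i\<close>; it is the truncation
  usually written with the bound \<open>\<le> i - 1\<close>, and \<open>0\<close> for \<open>i = 0\<close>.\<close>

definition cyc_trunc :: "nat \<Rightarrow> nat \<Rightarrow> int \<Rightarrow> nat \<Rightarrow> int" where
  "cyc_trunc l n \<gamma> i = (\<Sum>k<i. cyc_digit l n \<gamma> k * int l ^ k)"

text \<open>For \<open>1 \<le> a \<le> l - 1\<close>: the \<open>a\<close>-th smallest element (counted from 1) of the digits other than
  the \<open>m\<close>-th digit of the cyclotomic \<open>l\<close>-adic integer.\<close>

definition other_digit :: "nat \<Rightarrow> nat \<Rightarrow> int \<Rightarrow> nat \<Rightarrow> nat \<Rightarrow> int" where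
  "other_digit l n \<gamma> m a = sorted_list_of_set ({0..int l - 1} - {cyc_digit l n \<gamma> m}) ! (a - 1)"

definition cyc_U :: "nat \<Rightarrow> nat \<Rightarrow> int \<Rightarrow> nat \<Rightarrow> nat \<Rightarrow> int" where
  "cyc_U l n \<gamma> m a = (\<Sum>k<m. cyc_digit l n \<gamma> k * int l ^ k) + other_digit l n \<gamma> m a * int l ^ m"

definition c_inf :: "nat \<Rightarrow> nat \<Rightarrow> nat \<Rightarrow> int \<Rightarrow> nat \<Rightarrow> int set" where
  "c_inf q l n \<gamma> = (\<lambda>i. cyc_coset q (l ^ i * n) (\<gamma> + int n * cyc_trunc l n \<gamma> i))"

definition c_fin :: "nat \<Rightarrow> nat \<Rightarrow> nat \<Rightarrow> int \<Rightarrow> nat \<Rightarrow> nat \<Rightarrow> nat \<Rightarrow> nat \<Rightarrow> int set" where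
  "c_fin q l n \<gamma> m a t =
     (\<lambda>i. cyc_coset q (l ^ i * n) (\<gamma> + int n * (cyc_U l n \<gamma> m a + int l ^ (m + 1) * int t)))"

end

(* Restrict C_i to the residues gamma + n y: there multiplication by Q = q^tau acts, and in the
   coordinate z = y - phi(gamma) it is y |-> Q y + gamma (Q - 1) / n linearised to z |-> Q z.
   As l is odd, Q topologically generates 1 + l^v Z_l, so the orbits on Z_l are {0} and the
   classes l^m (u + l^v Z_l) with u a unit. The first orbit is c_inf; the others are told apart
   by m, by the first digit of y that differs from that of phi(gamma), and by the next v - 1
   digits of y. The size of the coset of z modulo l^i n is tau times the period of z under Q
   modulo l^i, so splitting fails at degree m + v for the orbits of valuation m. Everything is
   done with integer representatives modulo l^i in place of Z_l. *)

theory Submission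
  imports Defs "HOL-Number_Theory.Residues"
begin

subsection \<open>Cyclotomic cosets\<close>

text \<open>Euler's theorem gives a positive exponent that fixes every residue, so the
  \<open>LEAST\<close> is attained.\<close>

lemma coset_period:
  assumes "coprime q M" and "M > 0"
  shows "0 < coset_period q M a" and "[a * int q ^ coset_period q M a = a] (mod int M)"
proof -
  have "[q ^ totient M = 1] (mod M)"
    using assms by (intro euler_theorem) auto
  then have "[int q ^ totient M = 1] (mod int M)"
    by (metis cong_int_iff of_nat_1 of_nat_power)
  then have "[a * int q ^ totient M = a] (mod int M)"
    using cong_scalar_left[of "int q ^ totient M" 1 "int M" a] by simp
  moreover have "0 < totient M" using assms by simp
  ultimately have "0 < totient M \<and> [a * int q ^ totient M = a] (mod int M)" by simp
  then have "0 < coset_period q M a \<and> [a * int q ^ coset_period q M a = a] (mod int M)"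
    unfolding coset_period_def by (rule LeastI)
  then show "0 < coset_period q M a" and "[a * int q ^ coset_period q M a = a] (mod int M)"
    by auto
qed

lemma cong_power_mult_fixed:
  fixes a b M :: int
  assumes "[a * b = a] (mod M)"
  shows "[a * b ^ k = a] (mod M)"
proof (induction k)
  case (Suc k)
  have "[a * b ^ k * b = a * b] (mod M)" by (intro cong_mult Suc cong_refl)
  then show ?case using assms by (metis cong_trans mult.assoc power_Suc2)
qed simp

text \<open>Division with remainder: a nonzero remainder of \<open>j\<close> would be a smaller
  period.\<close>

lemma coset_period_dvd_iff:
  assumes "coprime q M" and "M > 0"
  shows "[a * int q ^ j = a] (mod int M) \<longleftrightarrow> coset_period q M a dvd j"
proof
  let ?P = "coset_period q M a"
  note P = coset_period[OF assms, of a]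
  have per: "[a * int q ^ (?P * k) = a] (mod int M)" for k
    using cong_power_mult_fixed[OF P(2)] by (simp add: power_mult)
  show "[a * int q ^ j = a] (mod int M)" if "?P dvd j"
    using that per by auto
  show "?P dvd j" if j: "[a * int q ^ j = a] (mod int M)"
  proof (rule ccontr)
    assume "\<not> ?P dvd j"
    then have r: "0 < j mod ?P" by (simp add: mod_greater_zero_iff_not_dvd)
    have "a * int q ^ j = (a * int q ^ (?P * (j div ?P))) * int q ^ (j mod ?P)"
      by (simp add: mult.assoc flip: power_add)
    moreover have "[(a * int q ^ (?P * (j div ?P))) * int q ^ (j mod ?P) = a * int q ^ (j mod ?P)] (mod int M)"
      by (intro cong_mult per cong_refl)
    ultimately have "[a * int q ^ (j mod ?P) = a] (mod int M)"
      using j by (metis cong_sym cong_trans)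
    with r have "0 < j mod ?P \<and> [a * int q ^ (j mod ?P) = a] (mod int M)" by simp
    then have "(LEAST t. 0 < t \<and> [a * int q ^ t = a] (mod int M)) \<le> j mod ?P" by (rule Least_le)
    then have "?P \<le> j mod ?P" by (simp only: coset_period_def)
    moreover have "j mod ?P < ?P" using P(1) by simp
    ultimately show False by simp
  qed
qed

text \<open>Reducing exponents modulo the period lets later arguments use arbitrary
  exponents.\<close>

lemma cyc_coset_eq_range:
  assumes "coprime q M" and "M > 0"
  shows "cyc_coset q M a = range (\<lambda>j. (a * int q ^ j) mod int M)"
proof -
  let ?P = "coset_period q M a"
  note P = coset_period[OF assms, of a]
  have "(a * int q ^ j) mod int M \<in> cyc_coset q M a" for j
  proof -
    have "a * int q ^ j = (a * int q ^ (?P * (j div ?P))) * int q ^ (j mod ?P)"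
      by (simp add: mult.assoc flip: power_add)
    moreover have "[(a * int q ^ (?P * (j div ?P))) * int q ^ (j mod ?P) = a * int q ^ (j mod ?P)] (mod int M)"
      using coset_period_dvd_iff[OF assms] by (intro cong_mult cong_refl) simp
    ultimately have "(a * int q ^ j) mod int M = (a * int q ^ (j mod ?P)) mod int M"
      by (simp only: cong_def)
    moreover have "j mod ?P \<in> {..<?P}" using P(1) by simp
    ultimately show ?thesis unfolding cyc_coset_def by (rule image_eqI)
  qed
  then show ?thesis by (auto simp: cyc_coset_def)
qed

text \<open>If two exponents below the period gave the same residue, cancelling the unit
  \<open>q ^ i\<close> would make the period divide their difference.\<close>

lemma card_cyc_coset:
  assumes "coprime q M" and "M > 0"
  shows "card (cyc_coset q M a) = coset_period q M a"
proof -
  have eq: "i = j" if "i \<le> j" "j < coset_period q M a"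
    and eq: "(a * int q ^ i) mod int M = (a * int q ^ j) mod int M" for i j
  proof -
    have "int q ^ j = int q ^ i * int q ^ (j - i)" using that(1) by (simp flip: power_add)
    then have "int q ^ i * (a * int q ^ (j - i)) = a * int q ^ j" by (simp only: mult_ac)
    moreover have "int q ^ i * a = a * int q ^ i" by (rule mult.commute)
    ultimately have "[int q ^ i * (a * int q ^ (j - i)) = int q ^ i * a] (mod int M)"
      by (simp only: eq cong_def)
    moreover have "coprime (int q ^ i) (int M)" using assms by simp
    ultimately have "[a * int q ^ (j - i) = a] (mod int M)"
      by (simp add: cong_mult_lcancel)
    then have "coset_period q M a dvd j - i"
      by (simp add: coset_period_dvd_iff[OF assms])
    then show "i = j" using that(1,2) dvd_imp_le[of "coset_period q M a" "j - i"] by (cases "i = j") auto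
  qed
  have "inj_on (\<lambda>j. (a * int q ^ j) mod int M) {..<coset_period q M a}"
  proof (rule inj_onI)
    fix i j
    assume "i \<in> {..<coset_period q M a}" "j \<in> {..<coset_period q M a}"
      and *: "(a * int q ^ i) mod int M = (a * int q ^ j) mod int M"
    then have "i < coset_period q M a" "j < coset_period q M a" by simp_all
    then show "i = j" using eq[OF _ _ *] eq[OF _ _ *[symmetric]] by (metis nle_le)
  qed
  then show ?thesis by (simp add: cyc_coset_def card_image)
qed

lemma cyc_coset_subsetI:
  assumes "coprime q M" and "M > 0" and "[b = a * int q ^ j] (mod int M)"
  shows "cyc_coset q M b \<subseteq> cyc_coset q M a"
proof
  fix x assume "x \<in> cyc_coset q M b"
  then obtain k where x: "x = (b * int q ^ k) mod int M"
    by (auto simp: cyc_coset_eq_range[OF assms(1,2)])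
  have "[b * int q ^ k = (a * int q ^ j) * int q ^ k] (mod int M)"
    by (intro cong_mult assms cong_refl)
  then have "x = (a * int q ^ (j + k)) mod int M"
    by (simp add: x cong_def power_add mult.assoc)
  then show "x \<in> cyc_coset q M a"
    unfolding cyc_coset_eq_range[OF assms(1,2)] by (rule range_eqI)
qed

lemma cyc_coset_eq_iff:
  assumes "coprime q M" and "M > 0"
  shows "cyc_coset q M a = cyc_coset q M b \<longleftrightarrow> (\<exists>j. [b = a * int q ^ j] (mod int M))"
proof
  assume eq: "cyc_coset q M a = cyc_coset q M b"
  have "(b * int q ^ 0) mod int M \<in> cyc_coset q M b"
    unfolding cyc_coset_eq_range[OF assms] by (rule rangeI)
  then have "b mod int M \<in> range (\<lambda>j. (a * int q ^ j) mod int M)"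
    by (simp add: eq[symmetric] cyc_coset_eq_range[OF assms, symmetric])
  then show "\<exists>j. [b = a * int q ^ j] (mod int M)"
    unfolding cong_def by (elim rangeE) (rule exI)
next
  let ?P = "coset_period q M a"
  assume "\<exists>j. [b = a * int q ^ j] (mod int M)"
  then obtain j where j: "[b = a * int q ^ j] (mod int M)" by blast
  \<comment> \<open>Multiplication by \<open>q\<close> to the power \<open>?P * j - j\<close> undoes
    multiplication of \<open>a\<close> by \<open>q ^ j\<close>; the subtraction is exact because
    \<open>?P\<close> is at least 1.\<close>
  have "1 \<le> ?P" using coset_period(1)[OF assms, of a] by simp
  then have Pj: "j + (?P * j - j) = ?P * j" by simp
  have "[b * int q ^ (?P * j - j) = (a * int q ^ j) * int q ^ (?P * j - j)] (mod int M)"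
    by (intro cong_mult j cong_refl)
  also have "(a * int q ^ j) * int q ^ (?P * j - j) = a * int q ^ (?P * j)"
    by (metis Pj mult.assoc power_add)
  also have "[a * int q ^ (?P * j) = a] (mod int M)"
    by (simp add: coset_period_dvd_iff[OF assms])
  finally show "cyc_coset q M a = cyc_coset q M b"
    using cyc_coset_subsetI[OF assms j] cyc_coset_subsetI[OF assms cong_sym]
    by (intro equalityI)
qed

lemma cyc_coset_proj:
  assumes "coprime q M" and "M > 0" and "M' dvd M"
  shows "(\<lambda>x. x mod int M') ` cyc_coset q M a = cyc_coset q M' a"
proof -
  have "coprime q M'" "M' > 0"
    using assms coprime_divisors[of q q M' M] by (auto intro: Nat.gr0I)
  then show ?thesis
    using assms by (simp add: cyc_coset_eq_range image_image mod_mod_cancel)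
qed

subsection \<open>Powers of an integer congruent to 1 modulo an odd prime\<close>

text \<open>The binomial expansion cut after its linear term. It serves with
  \<open>z = Q - 1\<close> modulo the square of \<open>l\<close>, and with \<open>z\<close> of
  valuation \<open>v + s\<close> modulo the next power of \<open>l\<close>.\<close>

lemma power_one_plus_cong:
  fixes z M :: int
  assumes "M dvd z ^ 2"
  shows "[(1 + z) ^ r = 1 + int r * z] (mod M)"
proof (induction r)
  case (Suc r)
  have "[(1 + z) ^ Suc r = (1 + z) * (1 + int r * z)] (mod M)"
    using Suc by (simp add: cong_scalar_left)
  also have "(1 + z) * (1 + int r * z) = 1 + int (Suc r) * z + int r * z ^ 2"
    by (simp add: algebra_simps power2_eq_square)
  also have "[\<dots> = 1 + int (Suc r) * z] (mod M)"
    using assms by (simp add: cong_iff_dvd_diff)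
  finally show ?case .
qed simp

text \<open>In the factorisation of \<open>Q ^ l - 1\<close> as \<open>Q - 1\<close> times a
  geometric sum, the sum is congruent to \<open>l\<close> modulo the square of \<open>l\<close>, so
  it contributes exactly one factor \<open>l\<close>.\<close>

lemma lifting_exponent_step:
  fixes Q c :: int and l v :: nat
  assumes "prime l" "odd l" "v \<ge> 1" and Q: "Q = 1 + int l ^ v * c" and c: "\<not> int l dvd c"
  shows "\<exists>c'. Q ^ l = 1 + int l ^ Suc v * c' \<and> \<not> int l dvd c'"
proof -
  have lQ: "int l dvd Q - 1" using Q assms(3) by (simp add: dvd_power)
  then have l2: "int l ^ 2 dvd (Q - 1) ^ 2" by (rule dvd_power_same)
  have "[(\<Sum>j<l. Q ^ j) = (\<Sum>j<l. 1 + int j * (Q - 1))] (mod int l ^ 2)"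
    using power_one_plus_cong[OF l2] by (intro cong_sum) simp
  also have "(\<Sum>j<l. 1 + int j * (Q - 1)) = int l + int (\<Sum>j<l. j) * (Q - 1)"
    by (simp add: sum.distrib sum_distrib_right)
  also have "[\<dots> = int l] (mod int l ^ 2)"
  proof -
    \<comment> \<open>Here oddness enters: \<open>l\<close> divides the sum of the numbers below
      \<open>l\<close> because 2 can be cancelled.\<close>
    have "2 * (\<Sum>j<l. j) = l * (l - 1)"
      by (induction l) (auto simp: algebra_simps)
    then have "l dvd 2 * (\<Sum>j<l. j)" by simp
    moreover have "coprime l 2" using assms(2) by simp
    ultimately have "l dvd (\<Sum>j<l. j)" by (metis coprime_dvd_mult_right_iff)
    then have "int l dvd int (\<Sum>j<l. j)" by (simp only: int_dvd_int_iff)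
    then have "int l ^ 2 dvd int (\<Sum>j<l. j) * (Q - 1)"
      using lQ by (simp only: power2_eq_square mult_dvd_mono)
    then show ?thesis by (simp only: cong_iff_dvd_diff add_diff_cancel_left')
  qed
  finally have "int l ^ 2 dvd (\<Sum>j<l. Q ^ j) - int l" by (simp add: cong_iff_dvd_diff)
  then obtain k where "(\<Sum>j<l. Q ^ j) - int l = int l ^ 2 * k" by (elim dvdE)
  then have k: "(\<Sum>j<l. Q ^ j) = int l * (1 + int l * k)"
    by (simp add: algebra_simps power2_eq_square)
  have "Q ^ l - 1 = (Q - 1) * (\<Sum>j<l. Q ^ j)" by (rule power_diff_1_eq)
  then have "Q ^ l = 1 + int l ^ Suc v * (c * (1 + int l * k))"
    by (simp only: k) (simp add: Q algebra_simps)
  moreover have "\<not> int l dvd c * (1 + int l * k)"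
  proof -
    have "\<not> int l dvd 1 + int l * k"
      using prime_gt_1_nat[OF assms(1)] dvd_add_left_iff[of "int l" "int l * k" 1] by simp
    then show ?thesis using c assms(1) by (simp add: prime_dvd_mult_iff)
  qed
  ultimately show ?thesis by blast
qed

text \<open>Since \<open>c'\<close> is prime to \<open>l\<close>, the power \<open>l ^ s\<close> of
  \<open>Q\<close> differs from 1 in valuation exactly \<open>v + s\<close>; this is what lets one
  digit at a time be adjusted below.\<close>

lemma lifting_exponent:
  fixes Q c :: int and l v :: nat
  assumes "prime l" "odd l" "v \<ge> 1" and "Q = 1 + int l ^ v * c" and "\<not> int l dvd c"
  shows "\<exists>c'. Q ^ (l ^ s) = 1 + int l ^ (v + s) * c' \<and> \<not> int l dvd c'"
proof (induction s)
  case 0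
  then show ?case using assms by auto
next
  case (Suc s)
  then obtain c' where c': "Q ^ (l ^ s) = 1 + int l ^ (v + s) * c'" "\<not> int l dvd c'" by blast
  have "Q ^ (l ^ Suc s) = (Q ^ (l ^ s)) ^ l"
    by (simp only: power_Suc2 power_mult)
  then show ?case
    using lifting_exponent_step[OF assms(1,2) _ c'] assms(3) by auto
qed

text \<open>For odd \<open>l\<close> the powers of \<open>Q\<close> fill \<open>1 + l ^ v \<int>\<close> modulo every power of \<open>l\<close>, so an orbit of
  multiplication by \<open>Q\<close> is a full residue class.\<close>

lemma power_orbit_iff:
  fixes Q c u x w :: int and l v m i :: nat
  assumes l: "prime l" "odd l" and v: "v \<ge> 1" and Q: "Q = 1 + int l ^ v * c" and c: "\<not> int l dvd c"
    and x: "x = int l ^ m * u" and u: "\<not> int l dvd u"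
  shows "(\<exists>k. [w = x * Q ^ k] (mod int l ^ i)) \<longleftrightarrow> [w = x] (mod int l ^ min i (m + v))"
proof
  assume "\<exists>k. [w = x * Q ^ k] (mod int l ^ i)"
  then obtain k where k: "[w = x * Q ^ k] (mod int l ^ i)" by blast
  have "int l ^ v dvd Q ^ k - 1"
    using power_diff_1_eq[of Q k] by (simp add: Q)
  then have "int l ^ (m + v) dvd x * (Q ^ k - 1)"
    by (simp add: x power_add mult_dvd_mono)
  then have "[x * Q ^ k = x] (mod int l ^ (m + v))"
    by (simp add: cong_iff_dvd_diff right_diff_distrib)
  then have "[x * Q ^ k = x] (mod int l ^ min i (m + v))"
    by (rule cong_dvd_modulus) (simp add: le_imp_power_dvd)
  moreover have "[w = x * Q ^ k] (mod int l ^ min i (m + v))"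
    using k by (rule cong_dvd_modulus) (simp add: le_imp_power_dvd)
  ultimately show "[w = x] (mod int l ^ min i (m + v))" using cong_trans by blast
next
  assume w: "[w = x] (mod int l ^ min i (m + v))"
  show "\<exists>k. [w = x * Q ^ k] (mod int l ^ i)"
  proof (cases "i \<le> m + v")
    case True
    then show ?thesis using w by (intro exI[of _ 0]) (simp add: min_def)
  next
    case False
    then have w': "[w = x] (mod int l ^ (m + v))" using w by (simp add: min_def)
    \<comment> \<open>Induction on the number \<open>s\<close> of digits matched beyond the first
      \<open>m + v\<close>: replacing \<open>k\<close> by \<open>k + l ^ s * r'\<close> keeps the
      digits already matched and shifts the next one.\<close>
    have "\<exists>k. [w = x * Q ^ k] (mod int l ^ (m + v + s))" for s
    proof (induction s)
      case 0
      then show ?case using w' by (intro exI[of _ 0]) simp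
    next
      case (Suc s)
      then obtain k where "[w = x * Q ^ k] (mod int l ^ (m + v + s))" by blast
      then have "int l ^ (m + v + s) dvd w - x * Q ^ k" by (simp add: cong_iff_dvd_diff)
      then obtain b where "w - x * Q ^ k = int l ^ (m + v + s) * b" by (elim dvdE)
      then have b: "w = x * Q ^ k + int l ^ (m + v + s) * b" by simp
      obtain c' where c': "Q ^ (l ^ s) = 1 + int l ^ (v + s) * c'" "\<not> int l dvd c'"
        using lifting_exponent[OF l v Q c] by blast
      have "int l dvd Q - 1" using v by (simp add: Q dvd_power)
      then have "[Q = 1] (mod int l)" by (simp add: cong_iff_dvd_diff)
      then have "[Q ^ k = 1 ^ k] (mod int l)" by (rule cong_pow)
      then have "\<not> int l dvd Q ^ k"
        using prime_gt_1_nat[OF l(1)] cong_dvd_iff[of "Q ^ k" "1" "int l"] by simp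
      then have "coprime (u * Q ^ k * c') (int l)"
        using u c'(2) l(1) by (metis coprime_commute prime_dvd_multD prime_imp_coprime prime_nat_int_transfer)
      \<comment> \<open>The discrepancy \<open>b\<close> in the next digit is removed by solving a
        linear congruence with unit coefficient; \<open>r'\<close> is a natural representative of
        \<open>r\<close>, as an exponent requires.\<close>
      then obtain r where r: "[u * Q ^ k * c' * r = b] (mod int l)"
        by (metis cong_scalar_right cong_solve_coprime_int mult.assoc mult_1)
      define r' where "r' = nat (r mod int l)"
      have r': "int r' = r mod int l" using prime_gt_0_nat[OF l(1)] by (simp add: r'_def)
      have "[u * Q ^ k * c' * int r' = b] (mod int l)"
        using r by (simp add: r' cong_def mod_simps)
      then have "[b = u * Q ^ k * c' * int r'] (mod int l)" by (rule cong_sym)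
      then have rb: "int l dvd b - u * Q ^ k * c' * int r'" by (simp add: cong_iff_dvd_diff)
      \<comment> \<open>Quadratic terms vanish because \<open>2 * (v + s)\<close> is at least
        \<open>v + s + 1\<close> when \<open>v\<close> is positive.\<close>
      have "int l ^ Suc (v + s) dvd (int l ^ (v + s) * c') ^ 2"
      proof -
        have "int l ^ Suc (v + s) dvd int l ^ ((v + s) * 2)"
          using v by (intro le_imp_power_dvd) simp
        then show ?thesis by (simp only: power_mult_distrib power_mult dvd_mult2)
      qed
      then have "[(Q ^ (l ^ s)) ^ r' = 1 + int r' * (int l ^ (v + s) * c')] (mod int l ^ Suc (v + s))"
        unfolding c'(1) by (rule power_one_plus_cong)
      then have "int l ^ Suc (v + s) dvd Q ^ (l ^ s * r') - (1 + int r' * (int l ^ (v + s) * c'))"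
        by (simp add: cong_iff_dvd_diff power_mult)
      then have "int l ^ m * int l ^ Suc (v + s) dvd
          (x * Q ^ k) * (Q ^ (l ^ s * r') - (1 + int r' * (int l ^ (v + s) * c')))"
        by (intro mult_dvd_mono) (simp_all add: x)
      then have 1: "int l ^ (m + v + Suc s) dvd
          (x * Q ^ k) * (Q ^ (l ^ s * r') - (1 + int r' * (int l ^ (v + s) * c')))"
        by (simp add: power_add mult_ac)
      have "int l ^ (m + v + s) * int l dvd int l ^ (m + v + s) * (b - u * Q ^ k * c' * int r')"
        using rb by (intro mult_dvd_mono) auto
      then have 2: "int l ^ (m + v + Suc s) dvd int l ^ (m + v + s) * (b - u * Q ^ k * c' * int r')"
        by (simp add: mult.commute)
      \<comment> \<open>The error is the corrected digit minus the nonlinear remainder, and both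
        vanish modulo the next power.\<close>
      have "w - x * Q ^ (k + l ^ s * r') =
          int l ^ (m + v + s) * (b - u * Q ^ k * c' * int r') -
          (x * Q ^ k) * (Q ^ (l ^ s * r') - (1 + int r' * (int l ^ (v + s) * c')))"
        by (simp add: b x power_add algebra_simps)
      then have "[w = x * Q ^ (k + l ^ s * r')] (mod int l ^ (m + v + Suc s))"
        using 1 2 by (simp only: cong_iff_dvd_diff dvd_diff)
      then show ?case by blast
    qed
    from this[of "i - (m + v)"] show ?thesis using False by simp
  qed
qed

subsection \<open>Cosets over a fixed residue\<close>

text \<open>The valuation \<open>v\<close> is recorded as a factorisation with cofactor
  \<open>c\<close> prime to \<open>l\<close>, the form in which \<open>power_orbit_iff\<close> takes
  it.\<close>

locale cyc_tower =
  fixes q l n \<tau> v :: nat and \<gamma> c :: int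
  assumes coprime_q_n: "coprime q n" and coprime_q_l: "coprime q l"
    and prime_l: "prime l" and odd_l: "odd l"
    and n_pos: "n > 0" and l_n: "\<not> l dvd n"
    and \<tau>_eq: "\<tau> = coset_period q n \<gamma>"
    and v_pos: "v \<ge> 1"
    and Q_eq: "int q ^ \<tau> = 1 + int l ^ v * c" and l_c: "\<not> int l dvd c"
begin

lemma l_gt_1: "l > 1"
  using prime_l by (rule prime_gt_1_nat)

lemma coprime_q_level: "coprime q (l ^ i * n)"
  using coprime_q_n coprime_q_l by simp

lemma level_pos: "l ^ i * n > 0"
  using n_pos l_gt_1 by simp

lemma coprime_l_n: "coprime (int l) (int n)"
  using prime_l l_n by (simp add: prime_imp_coprime)

text \<open>Chinese remainder theorem: the factor \<open>n\<close> restricts the exponents, and the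
  factor \<open>l ^ i\<close> is left for the \<open>l\<close>-adic analysis.\<close>

lemma cong_level_iff:
  "[w = x] (mod int (l ^ i * n)) \<longleftrightarrow> [w = x] (mod int l ^ i) \<and> [w = x] (mod int n)"
proof -
  have "coprime (int l ^ i) (int n)" using coprime_l_n by simp
  then show ?thesis
    using coprime_cong_mult[of w x "int l ^ i" "int n"] cong_modulus_mult[of w x "int l ^ i" "int n"]
      cong_modulus_mult[of w x "int n" "int l ^ i"]
    by (auto simp: mult.commute)
qed

lemma cong_n_mult_cancel: "[int n * a = int n * b] (mod int l ^ i) \<longleftrightarrow> [a = b] (mod int l ^ i)"
  using coprime_l_n by (intro cong_mult_lcancel) (simp add: coprime_commute)

lemma cong_base_iff:
  assumes "[x = \<gamma>] (mod int n)" and "[w = \<gamma>] (mod int n)"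
  shows "[w = x * int q ^ j] (mod int n) \<longleftrightarrow> \<tau> dvd j"
proof -
  have "[x * int q ^ j = \<gamma> * int q ^ j] (mod int n)"
    using assms(1) by (rule cong_scalar_right)
  then have "[w = x * int q ^ j] (mod int n) \<longleftrightarrow> [\<gamma> * int q ^ j = \<gamma>] (mod int n)"
    using assms(2) by (meson cong_sym cong_trans)
  then show ?thesis
    using coset_period_dvd_iff[OF coprime_q_n n_pos] by (simp add: \<tau>_eq)
qed

text \<open>Keeping the residue modulo \<open>n\<close> forces the exponent of \<open>q\<close> to
  be a multiple of \<tau>, so only powers of \<open>q ^ \<tau>\<close> act on the lifts of
  \<gamma>.\<close>

lemma level_coset_eq_iff:
  assumes "[x = \<gamma>] (mod int n)" and "[w = \<gamma>] (mod int n)"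
  shows "cyc_coset q (l ^ i * n) x = cyc_coset q (l ^ i * n) w \<longleftrightarrow>
    (\<exists>k. [w = x * (int q ^ \<tau>) ^ k] (mod int l ^ i))"
  unfolding cyc_coset_eq_iff[OF coprime_q_level level_pos] cong_level_iff cong_base_iff[OF assms]
  by (auto elim!: dvdE simp: power_mult) (metis dvd_triv_left power_mult)

text \<open>The orbit description for a lift of valuation exactly \<open>m\<close>: from degree
  \<open>m + v\<close> on, the condition no longer depends on \<open>i\<close>.\<close>

lemma level_coset_eq_iff_cong:
  assumes "[x = \<gamma>] (mod int n)" and "[w = \<gamma>] (mod int n)"
    and "int l ^ m dvd x" and "\<not> int l ^ Suc m dvd x"
  shows "cyc_coset q (l ^ i * n) x = cyc_coset q (l ^ i * n) w \<longleftrightarrow> [w = x] (mod int l ^ min i (m + v))"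
proof -
  obtain u where u: "x = int l ^ m * u" using assms(3) by (elim dvdE)
  moreover have "\<not> int l dvd u"
    using assms(4) by (auto simp: u mult_dvd_mono mult.commute)
  ultimately show ?thesis
    unfolding level_coset_eq_iff[OF assms(1,2)]
    by (rule power_orbit_iff[OF prime_l odd_l v_pos Q_eq l_c])
qed

text \<open>The factor \<open>n\<close> makes the period a multiple of \<tau>, and the divisibility
  assumption makes \<tau> itself a period.\<close>

lemma card_level_coset:
  assumes "[x = \<gamma>] (mod int n)" and "int l ^ i dvd x * (int q ^ \<tau> - 1)"
  shows "card (cyc_coset q (l ^ i * n) x) = \<tau>"
proof -
  let ?P = "coset_period q (l ^ i * n) x"
  have n_iff: "[x * int q ^ j = x] (mod int n) \<longleftrightarrow> \<tau> dvd j" for j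
    using cong_base_iff[OF assms(1) assms(1)] by (simp add: cong_sym_eq)
  have "[x * int q ^ ?P = x] (mod int (l ^ i * n))"
    using coset_period_dvd_iff[OF coprime_q_level level_pos] by simp
  then have "\<tau> dvd ?P" by (simp only: cong_level_iff n_iff)
  moreover have "[x * int q ^ \<tau> = x] (mod int (l ^ i * n))"
    using assms(2) n_iff[of \<tau>] by (simp only: cong_level_iff) (simp add: cong_iff_dvd_diff algebra_simps)
  then have "?P dvd \<tau>" by (simp only: coset_period_dvd_iff[OF coprime_q_level level_pos])
  ultimately show ?thesis
    by (simp only: card_cyc_coset[OF coprime_q_level level_pos] dvd_antisym)
qed

subsection \<open>The truncations of the cyclotomic integer\<close>

text \<open>Multiplying the quotient by the unit \<open>n\<close> in the ring and reading off
  component \<open>i\<close> turns the \<open>l\<close>-adic definition into an integer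
  congruence.\<close>

lemma cyc_ladic_closed: "cyc_ladic l n \<gamma> \<in> carrier (ladic_ring l)"
  and n_mult_cyc_ladic: "[int n * cyc_ladic l n \<gamma> i = - \<gamma>] (mod int l ^ i)"
proof -
  interpret R: cring "ladic_ring l" by (rule ladic_ring_cring)
  let ?n = "ladic_of_int l (int n)" and ?g = "ladic_of_int l (- \<gamma>)"
  have U: "?n \<in> Units (ladic_ring l)"
    using coprime_l_n l_gt_1 by (intro ladic_of_int_Unit) (simp_all add: coprime_commute)
  have cl: "?n \<in> carrier (ladic_ring l)" "?g \<in> carrier (ladic_ring l)"
    by (rule ladic_of_int_closed)+
  show cl': "cyc_ladic l n \<gamma> \<in> carrier (ladic_ring l)"
    unfolding cyc_ladic_def using U cl by simp
  have "?n \<otimes>\<^bsub>ladic_ring l\<^esub> cyc_ladic l n \<gamma> = ?g"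
    unfolding cyc_ladic_def using U cl
    by (metis R.Units_inv_closed R.Units_r_inv R.m_lcomm R.r_one)
  then have "(?n \<otimes>\<^bsub>ladic_ring l\<^esub> cyc_ladic l n \<gamma>) i = ?g i" by simp
  then show "[int n * cyc_ladic l n \<gamma> i = - \<gamma>] (mod int l ^ i)"
    by (simp add: ladic_ring_def ladic_of_int_def cong_def mod_simps)
qed

lemma cyc_digit_expansion: "ladic_expansion l (cyc_ladic l n \<gamma>) (cyc_digit l n \<gamma>)"
  unfolding cyc_digit_def ladic_digit_def
  using theI'[OF ladic_expansion_ex1[OF _ cyc_ladic_closed]] l_gt_1 by simp

lemma cyc_digit_bounds: "0 \<le> cyc_digit l n \<gamma> k" "cyc_digit l n \<gamma> k < int l"
  using cyc_digit_expansion by (auto simp: ladic_expansion_def)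

lemma cyc_trunc_Suc: "cyc_trunc l n \<gamma> (Suc i) = cyc_trunc l n \<gamma> i + cyc_digit l n \<gamma> i * int l ^ i"
  by (simp add: cyc_trunc_def)

lemma cyc_trunc_cong:
  assumes "i \<le> j"
  shows "[cyc_trunc l n \<gamma> j = cyc_trunc l n \<gamma> i] (mod int l ^ i)"
  using assms
proof (induction j rule: dec_induct)
  case (step j)
  have "int l ^ i dvd cyc_digit l n \<gamma> j * int l ^ j"
    using step(1) by (simp add: le_imp_power_dvd)
  then have "[cyc_trunc l n \<gamma> (Suc j) = cyc_trunc l n \<gamma> j] (mod int l ^ i)"
    by (simp add: cyc_trunc_Suc cong_iff_dvd_diff)
  then show ?case using step(3) by (rule cong_trans)
qed simp

lemma cyc_trunc_bounds: "0 \<le> cyc_trunc l n \<gamma> i \<and> cyc_trunc l n \<gamma> i < int l ^ i"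
proof (induction i)
  case (Suc i)
  have "cyc_digit l n \<gamma> i * int l ^ i \<le> (int l - 1) * int l ^ i"
    using cyc_digit_bounds[of i] by (intro mult_right_mono) auto
  then show ?case
    using Suc cyc_digit_bounds[of i] by (simp add: cyc_trunc_Suc algebra_simps)
qed (simp add: cyc_trunc_def)

text \<open>Convergence makes component \<open>i\<close> correct only for late partial sums, but
  digits from index \<open>i\<close> on contribute multiples of \<open>l ^ i\<close>.\<close>

lemma cyc_trunc_cong_cyc_ladic: "[cyc_trunc l n \<gamma> i = cyc_ladic l n \<gamma> i] (mod int l ^ i)"
proof -
  obtain N where N: "\<And>K. K \<ge> N \<Longrightarrow> cyc_trunc l n \<gamma> K mod int l ^ i = cyc_ladic l n \<gamma> i"
    using cyc_digit_expansion
    unfolding ladic_expansion_def ladic_of_int_def eventually_sequentially cyc_trunc_def by blast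
  have "[cyc_trunc l n \<gamma> (i + N) = cyc_trunc l n \<gamma> i] (mod int l ^ i)"
    by (rule cyc_trunc_cong) simp
  then show ?thesis
    using N[of "i + N"] by (metis cong_def le_add2 mod_mod_trivial)
qed

text \<open>With \<phi> the cyclotomic integer, the lift is \<open>n\<close> times the difference of
  \<open>y\<close> and \<phi>, and \<open>n\<close> is a unit at \<open>l\<close>. So its valuation
  counts the initial digits that \<open>y\<close> shares with \<phi>.\<close>

lemma dvd_lift_iff: "int l ^ i dvd \<gamma> + int n * y \<longleftrightarrow> [y = cyc_trunc l n \<gamma> i] (mod int l ^ i)"
proof -
  have "[int n * cyc_trunc l n \<gamma> i = int n * cyc_ladic l n \<gamma> i] (mod int l ^ i)"
    using cyc_trunc_cong_cyc_ladic by (rule cong_scalar_left)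
  then have T: "[int n * cyc_trunc l n \<gamma> i = - \<gamma>] (mod int l ^ i)"
    using n_mult_cyc_ladic by (rule cong_trans)
  have "int l ^ i dvd \<gamma> + int n * y \<longleftrightarrow> [int n * y = - \<gamma>] (mod int l ^ i)"
    by (simp add: cong_iff_dvd_diff add.commute)
  also have "\<dots> \<longleftrightarrow> [int n * y = int n * cyc_trunc l n \<gamma> i] (mod int l ^ i)"
    using T by (meson cong_sym cong_trans)
  also have "\<dots> \<longleftrightarrow> [y = cyc_trunc l n \<gamma> i] (mod int l ^ i)"
    by (rule cong_n_mult_cancel)
  finally show ?thesis .
qed

section \<open>Digits, size and valuation of the finite representatives\<close>

lemma bij_betw_other_digit:
  "bij_betw (other_digit l n \<gamma> m) {1..l - 1} ({0..int l - 1} - {cyc_digit l n \<gamma> m})"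
proof -
  let ?A = "{0..int l - 1} - {cyc_digit l n \<gamma> m}"
  let ?xs = "sorted_list_of_set ?A"
  have "card ?A = l - 1"
    using cyc_digit_bounds[of m] by (subst card_Diff_singleton) auto
  then have len: "length ?xs = l - 1" by (simp only: length_sorted_list_of_set)
  have "bij_betw ((!) ?xs) {..<l - 1} ?A"
    by (rule bij_betw_nth) (simp_all add: len del: length_sorted_list_of_set)
  moreover have "bij_betw (\<lambda>a. a - 1) {1..l - 1} {..<l - 1}"
    by (rule bij_betw_byWitness[where f' = Suc]) auto
  ultimately have "bij_betw ((!) ?xs \<circ> (\<lambda>a. a - 1)) {1..l - 1} ?A"
    by (rule bij_betw_trans[rotated])
  then show ?thesis
    by (simp add: other_digit_def[abs_def] comp_def)
qed

lemma other_digit: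
  assumes "a \<in> {1..l - 1}"
  shows "0 \<le> other_digit l n \<gamma> m a" "other_digit l n \<gamma> m a < int l"
    "other_digit l n \<gamma> m a \<noteq> cyc_digit l n \<gamma> m"
  using bij_betw_apply[OF bij_betw_other_digit assms, of m] by auto

lemma cyc_U_eq: "cyc_U l n \<gamma> m a = cyc_trunc l n \<gamma> m + other_digit l n \<gamma> m a * int l ^ m"
  by (simp add: cyc_U_def cyc_trunc_def)

lemma cyc_U_bounds:
  assumes "a \<in> {1..l - 1}"
  shows "0 \<le> cyc_U l n \<gamma> m a" "cyc_U l n \<gamma> m a < int l ^ Suc m"
proof -
  have "other_digit l n \<gamma> m a * int l ^ m \<le> (int l - 1) * int l ^ m"
    using other_digit[OF assms, of m] by (intro mult_right_mono) auto
  then show "0 \<le> cyc_U l n \<gamma> m a" "cyc_U l n \<gamma> m a < int l ^ Suc m"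
    using cyc_trunc_bounds[of m] other_digit[OF assms, of m] by (simp_all add: cyc_U_eq algebra_simps)
qed

text \<open>The digits below index \<open>m\<close> are those of the cyclotomic integer and the
  digit at \<open>m\<close> is not; \<open>t\<close> affects only later digits.\<close>

lemma lift_valuation:
  assumes "a \<in> {1..l - 1}"
  shows "int l ^ m dvd \<gamma> + int n * (cyc_U l n \<gamma> m a + int l ^ (m + 1) * t)"
    and "\<not> int l ^ Suc m dvd \<gamma> + int n * (cyc_U l n \<gamma> m a + int l ^ (m + 1) * t)"
proof -
  show "int l ^ m dvd \<gamma> + int n * (cyc_U l n \<gamma> m a + int l ^ (m + 1) * t)"
    by (simp add: dvd_lift_iff cyc_U_eq cong_iff_dvd_diff)
  have "cyc_U l n \<gamma> m a \<noteq> cyc_trunc l n \<gamma> (Suc m)"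
    using other_digit(3)[OF assms, of m] l_gt_1 by (simp add: cyc_U_eq cyc_trunc_Suc)
  then have "\<not> [cyc_U l n \<gamma> m a = cyc_trunc l n \<gamma> (Suc m)] (mod int l ^ Suc m)"
    using cyc_U_bounds[OF assms, of m] cyc_trunc_bounds[of "Suc m"]
    by (simp only: cong_def mod_pos_pos_trivial not_False_eq_True)
  moreover have "[cyc_U l n \<gamma> m a + int l ^ (m + 1) * t = cyc_U l n \<gamma> m a] (mod int l ^ Suc m)"
    by (simp add: cong_iff_dvd_diff)
  ultimately show "\<not> int l ^ Suc m dvd \<gamma> + int n * (cyc_U l n \<gamma> m a + int l ^ (m + 1) * t)"
    unfolding dvd_lift_iff by (meson cong_sym cong_trans)
qed

lemma fin_index_bound:
  assumes "t \<in> {0..l ^ (v - 1) - 1}"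
  shows "t < l ^ (v - 1)"
proof -
  have "0 < l ^ (v - 1)" using l_gt_1 by simp
  then show ?thesis using assms unfolding atLeastAtMost_iff by linarith
qed

text \<open>The \<open>m + 1\<close> digits of \<open>cyc_U\<close> and the \<open>v - 1\<close>
  digits of \<open>t\<close> form a reduced residue modulo \<open>l ^ (m + v)\<close>, so congruence
  of two such numbers is equality.\<close>

lemma fin_rep_bounds:
  assumes "a \<in> {1..l - 1}" and "t \<in> {0..l ^ (v - 1) - 1}"
  shows "0 \<le> cyc_U l n \<gamma> m a + int l ^ (m + 1) * int t"
    and "cyc_U l n \<gamma> m a + int l ^ (m + 1) * int t < int l ^ (m + v)"
proof -
  show "0 \<le> cyc_U l n \<gamma> m a + int l ^ (m + 1) * int t"
    using cyc_U_bounds(1)[OF assms(1)] by simp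
  have "int t \<le> int l ^ (v - 1) - 1"
    using fin_index_bound[OF assms(2)] by (metis int_less_real_le of_nat_less_iff of_nat_power zle_diff1_eq)
  then have "int l ^ (m + 1) * int t \<le> int l ^ (m + 1) * (int l ^ (v - 1) - 1)"
    by (intro mult_left_mono) auto
  also have "\<dots> = int l ^ (m + v) - int l ^ (m + 1)"
  proof -
    have "m + v = (m + 1) + (v - 1)" using v_pos by simp
    then have "int l ^ (m + v) = int l ^ (m + 1) * int l ^ (v - 1)" by (simp only: power_add)
    then show ?thesis by (simp only: right_diff_distrib mult_1_right)
  qed
  finally show "cyc_U l n \<gamma> m a + int l ^ (m + 1) * int t < int l ^ (m + v)"
    using cyc_U_bounds(2)[OF assms(1), of m] by simp
qed

subsection \<open>Sequences of lifts\<close>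

lemma lift_cong_base: "[\<gamma> + int n * y = \<gamma>] (mod int n)"
  by (simp add: cong_iff_dvd_diff)

text \<open>Coherent residues give compatible cosets. This is applied to the truncations and to
  constant sequences.\<close>

lemma lift_system:
  assumes "\<And>i j. i \<le> j \<Longrightarrow> [Y j = Y i] (mod int l ^ i)"
  shows "(\<lambda>i. cyc_coset q (l ^ i * n) (\<gamma> + int n * Y i)) \<in> cyc_system q l n \<gamma>"
proof -
  have proj: "(\<lambda>x. x mod int (l ^ i * n)) ` cyc_coset q (l ^ j * n) (\<gamma> + int n * Y j) =
      cyc_coset q (l ^ i * n) (\<gamma> + int n * Y i)" if "i \<le> j" for i j
  proof -
    have "l ^ i * n dvd l ^ j * n" using that by (simp add: le_imp_power_dvd)
    then have "(\<lambda>x. x mod int (l ^ i * n)) ` cyc_coset q (l ^ j * n) (\<gamma> + int n * Y j) =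
        cyc_coset q (l ^ i * n) (\<gamma> + int n * Y j)"
      by (rule cyc_coset_proj[OF coprime_q_level level_pos])
    moreover have "[\<gamma> + int n * Y i = (\<gamma> + int n * Y j) * (int q ^ \<tau>) ^ 0] (mod int l ^ i)"
      using cong_scalar_left[OF assms[OF that], of "int n"]
      by (simp add: cong_add_lcancel cong_sym_eq[of "int n * Y i"])
    ultimately show ?thesis
      using level_coset_eq_iff[OF lift_cong_base lift_cong_base] by blast
  qed
  have "cyc_coset q n \<gamma> = cyc_coset q n (\<gamma> + int n * Y 0)"
    unfolding cyc_coset_eq_iff[OF coprime_q_n n_pos] by (intro exI[of _ 0]) (simp add: lift_cong_base)
  then show ?thesis unfolding cyc_system_def using proj by auto
qed

lemma c_inf_system: "c_inf q l n \<gamma> \<in> cyc_system q l n \<gamma>"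
  unfolding c_inf_def by (rule lift_system) (rule cyc_trunc_cong)

lemma c_fin_system: "c_fin q l n \<gamma> m a t \<in> cyc_system q l n \<gamma>"
  unfolding c_fin_def by (rule lift_system) simp

text \<open>Each \<open>C i\<close> lies over the coset of \<gamma>, so a power of \<open>q\<close>
  moves a representative into the class of \<gamma> modulo \<open>n\<close>. The \<open>Y i\<close>
  themselves need not be coherent; only their cosets are.\<close>

lemma system_lifts:
  assumes "C \<in> cyc_system q l n \<gamma>"
  obtains Y where "\<And>i. C i = cyc_coset q (l ^ i * n) (\<gamma> + int n * Y i)"
    and "\<And>i j. i \<le> j \<Longrightarrow>
      cyc_coset q (l ^ i * n) (\<gamma> + int n * Y j) = cyc_coset q (l ^ i * n) (\<gamma> + int n * Y i)"
proof -
  have ex: "\<And>i. \<exists>\<delta>. C i = cyc_coset q (l ^ i * n) \<delta>" and C0: "C 0 = cyc_coset q n \<gamma>"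
    and proj: "\<And>i j. i \<le> j \<Longrightarrow> (\<lambda>x. x mod int (l ^ i * n)) ` C j = C i"
    using assms by (auto simp: cyc_system_def)
  have "\<exists>y. C i = cyc_coset q (l ^ i * n) (\<gamma> + int n * y)" for i
  proof -
    obtain \<delta> where \<delta>: "C i = cyc_coset q (l ^ i * n) \<delta>" using ex by blast
    have "cyc_coset q n \<delta> = cyc_coset q n \<gamma>"
      using cyc_coset_proj[OF coprime_q_level level_pos, of n i \<delta>] proj[of 0 i] by (simp add: \<delta> C0)
    then obtain j where "[\<gamma> = \<delta> * int q ^ j] (mod int n)"
      unfolding cyc_coset_eq_iff[OF coprime_q_n n_pos] by blast
    then have "[\<delta> * int q ^ j = \<gamma>] (mod int n)" by (rule cong_sym)
    then have "int n dvd \<delta> * int q ^ j - \<gamma>" by (simp only: cong_iff_dvd_diff)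
    then obtain y where "\<delta> * int q ^ j - \<gamma> = int n * y" by (elim dvdE)
    then have y: "\<gamma> + int n * y = \<delta> * int q ^ j" by simp
    have "cyc_coset q (l ^ i * n) \<delta> = cyc_coset q (l ^ i * n) (\<delta> * int q ^ j)"
      unfolding cyc_coset_eq_iff[OF coprime_q_level level_pos] by (rule exI, rule cong_refl)
    then have "C i = cyc_coset q (l ^ i * n) (\<gamma> + int n * y)" by (simp only: \<delta> y)
    then show ?thesis by blast
  qed
  then obtain Y where Y: "\<And>i. C i = cyc_coset q (l ^ i * n) (\<gamma> + int n * Y i)" by metis
  moreover have "cyc_coset q (l ^ i * n) (\<gamma> + int n * Y j) = cyc_coset q (l ^ i * n) (\<gamma> + int n * Y i)"
    if "i \<le> j" for i j
  proof -
    have "l ^ i * n dvd l ^ j * n" using that by (simp add: le_imp_power_dvd)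
    then show ?thesis
      using cyc_coset_proj[OF coprime_q_level level_pos, of "l ^ i * n" j "\<gamma> + int n * Y j"] proj[OF that]
      by (simp only: Y)
  qed
  ultimately show thesis by (rule that)
qed

text \<open>Powers of \<open>q\<close> are units at \<open>l\<close>, so the valuation, as far as
  degree \<open>i\<close> can see it, is an invariant of the coset.\<close>

lemma lift_dvd_cong:
  assumes "cyc_coset q (l ^ i * n) (\<gamma> + int n * y) = cyc_coset q (l ^ i * n) (\<gamma> + int n * z)"
    and "k \<le> i"
  shows "int l ^ k dvd \<gamma> + int n * y \<longleftrightarrow> int l ^ k dvd \<gamma> + int n * z"
proof -
  obtain r where "[\<gamma> + int n * z = (\<gamma> + int n * y) * (int q ^ \<tau>) ^ r] (mod int l ^ i)"
    using assms(1) level_coset_eq_iff[OF lift_cong_base lift_cong_base] by blast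
  then have "[\<gamma> + int n * z = (\<gamma> + int n * y) * (int q ^ \<tau>) ^ r] (mod int l ^ k)"
    using assms(2) by (rule cong_dvd_modulus[OF _ le_imp_power_dvd])
  then have "int l ^ k dvd \<gamma> + int n * z \<longleftrightarrow> int l ^ k dvd (\<gamma> + int n * y) * (int q ^ \<tau>) ^ r"
    by (rule cong_dvd_iff)
  also have "\<dots> \<longleftrightarrow> int l ^ k dvd \<gamma> + int n * y"
  proof -
    have "coprime (int l ^ k) ((int q ^ \<tau>) ^ r)"
      using coprime_q_l by (simp add: coprime_commute)
    then show ?thesis by (simp add: coprime_dvd_mult_left_iff)
  qed
  finally show ?thesis by blast
qed

section \<open>Classification of the compatible sequences\<close>

text \<open>Either every lift vanishes modulo \<open>l ^ i\<close>, which gives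
  \<open>c_inf\<close>, or the valuation stabilises at some \<open>m\<close>. Then one integer
  represents all cosets, and its first \<open>m + v\<close> digits yield \<open>a\<close> and
  \<open>t\<close>.\<close>

lemma system_cases:
  assumes "C \<in> cyc_system q l n \<gamma>"
  obtains "C = c_inf q l n \<gamma>"
    | m a t where "a \<in> {1..l - 1}" "t \<in> {0..l ^ (v - 1) - 1}" "C = c_fin q l n \<gamma> m a t"
proof -
  obtain Y where Y: "\<And>i. C i = cyc_coset q (l ^ i * n) (\<gamma> + int n * Y i)"
    and comp: "\<And>i j. i \<le> j \<Longrightarrow>
      cyc_coset q (l ^ i * n) (\<gamma> + int n * Y j) = cyc_coset q (l ^ i * n) (\<gamma> + int n * Y i)"
    using system_lifts[OF assms] by blast
  show thesis
  proof (cases "\<forall>i. int l ^ i dvd \<gamma> + int n * Y i")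
    case True
    have "C i = c_inf q l n \<gamma> i" for i
    proof -
      have "[cyc_trunc l n \<gamma> i = Y i] (mod int l ^ i)"
        using True by (auto simp: dvd_lift_iff cong_sym_eq)
      then have "[\<gamma> + int n * cyc_trunc l n \<gamma> i = (\<gamma> + int n * Y i) * (int q ^ \<tau>) ^ 0] (mod int l ^ i)"
        by (simp add: cong_add_lcancel cong_scalar_left)
      then show ?thesis
        unfolding Y c_inf_def using level_coset_eq_iff[OF lift_cong_base lift_cong_base] by blast
    qed
    then have "C = c_inf q l n \<gamma>" by (rule ext)
    then show thesis by (rule that(1))
  next
    case False
    then obtain i0 where i0: "\<not> int l ^ i0 dvd \<gamma> + int n * Y i0" by blast
    define m where "m = (LEAST j. \<not> int l ^ Suc j dvd \<gamma> + int n * Y i0)"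
    \<comment> \<open>This leads to \<open>m < i0\<close>, so degree \<open>i0\<close> already
      detects divisibility by both \<open>l ^ m\<close> and \<open>l ^ Suc m\<close>.\<close>
    have "i0 \<noteq> 0" using i0 by (metis one_dvd power_0)
    then have "\<not> int l ^ Suc (i0 - 1) dvd \<gamma> + int n * Y i0" using i0 by simp
    then have m: "\<not> int l ^ Suc m dvd \<gamma> + int n * Y i0" and "m \<le> i0 - 1"
      unfolding m_def by (rule LeastI, rule Least_le)
    then have "m < i0" using \<open>i0 \<noteq> 0\<close> by simp
    have m': "int l ^ m dvd \<gamma> + int n * Y i0"
    proof (cases m)
      case (Suc k)
      then show ?thesis using not_less_Least[of k "\<lambda>j. \<not> int l ^ Suc j dvd \<gamma> + int n * Y i0"]
        unfolding m_def[symmetric] by simp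
    qed simp
    \<comment> \<open>Degree \<open>I\<close> is at least \<open>i0\<close>, so the valuation
      \<open>m\<close> carries over, and at least \<open>m + v\<close>, so its coset fixes
      \<open>y\<close> modulo \<open>l ^ (m + v)\<close>.\<close>
    define I where "I = i0 + m + v"
    define y where "y = Y I"
    have val: "int l ^ m dvd \<gamma> + int n * y" "\<not> int l ^ Suc m dvd \<gamma> + int n * y"
      using m m' lift_dvd_cong[OF comp[of i0 I], of m] lift_dvd_cong[OF comp[of i0 I], of "Suc m"] \<open>m < i0\<close>
      by (simp_all add: I_def y_def)
    note eq_iff = level_coset_eq_iff_cong[OF lift_cong_base lift_cong_base val]
    have Cy: "C i = cyc_coset q (l ^ i * n) (\<gamma> + int n * y)" for i
    proof (cases "i \<le> I")
      case True
      then show ?thesis unfolding Y y_def by (rule comp[symmetric])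
    next
      case False
      then have "cyc_coset q (l ^ I * n) (\<gamma> + int n * y) = cyc_coset q (l ^ I * n) (\<gamma> + int n * Y i)"
        unfolding y_def by (intro comp[symmetric]) simp
      \<comment> \<open>Both degrees are past \<open>m + v\<close>, so equality of cosets at
        \<open>I\<close> and at \<open>i\<close> is the same congruence.\<close>
      moreover have "min I (m + v) = m + v" "min i (m + v) = m + v" using False by (auto simp: I_def)
      ultimately have "cyc_coset q (l ^ i * n) (\<gamma> + int n * y) = cyc_coset q (l ^ i * n) (\<gamma> + int n * Y i)"
        by (simp only: eq_iff)
      then show ?thesis unfolding Y by (rule sym)
    qed
    define z where "z = y mod int l ^ (m + v)"
    have lpos: "int l ^ k > 0" for k using l_gt_1 by simp
    have zy: "[z = y] (mod int l ^ (m + v))" by (simp add: z_def cong_def)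
    have z_bd: "0 \<le> z" "z < int l ^ (m + v)" using lpos[of "m + v"] by (simp_all add: z_def)
    have zyk: "[z = y] (mod int l ^ k)" if "k \<le> m + v" for k
      using zy that by (rule cong_dvd_modulus[OF _ le_imp_power_dvd])
    have zT: "[z = cyc_trunc l n \<gamma> m] (mod int l ^ m)"
      using zyk[of m] val(1) unfolding dvd_lift_iff by (meson cong_trans le_add1)
    have zT': "\<not> [z = cyc_trunc l n \<gamma> (Suc m)] (mod int l ^ Suc m)"
      using zyk[of "Suc m"] v_pos val(2) unfolding dvd_lift_iff by (auto dest: cong_sym cong_trans)
    \<comment> \<open>The digits of \<open>z\<close> are cut into three blocks: the first
      \<open>m\<close> form the truncation, the next is \<open>d\<close>, and the remaining
      \<open>v - 1\<close> form \<open>t\<close>.\<close>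
    define d where "d = (z div int l ^ m) mod int l"
    define t where "t = nat (z div int l ^ Suc m)"
    have tz: "int t = z div int l ^ Suc m"
      using pos_imp_zdiv_nonneg_iff[OF lpos[of "Suc m"], of z] z_bd(1) by (simp only: t_def int_nat_eq if_True)
    have zm: "z mod int l ^ m = cyc_trunc l n \<gamma> m"
      using zT cyc_trunc_bounds[of m] by (simp add: cong_def)
    have "z div int l ^ Suc m = z div int l ^ m div int l"
      by (simp only: power_Suc2 zdiv_zmult2_eq of_nat_0_le_iff)
    then have "z div int l ^ m = int l * int t + d"
      using mult_div_mod_eq[of "int l" "z div int l ^ m"] by (simp only: d_def tz)
    then have "z = int l ^ m * (int l * int t + d) + cyc_trunc l n \<gamma> m"
      using mult_div_mod_eq[of "int l ^ m" z] by (simp only: zm)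
    then have z_eq: "z = cyc_trunc l n \<gamma> m + d * int l ^ m + int l ^ (m + 1) * int t"
      by (simp add: algebra_simps)
    have "d \<noteq> cyc_digit l n \<gamma> m"
      using zT' by (auto simp: z_eq cyc_trunc_Suc cong_iff_dvd_diff)
    then have "d \<in> {0..int l - 1} - {cyc_digit l n \<gamma> m}"
      using l_gt_1 by (simp add: d_def)
    then obtain a where a: "a \<in> {1..l - 1}" and d: "d = other_digit l n \<gamma> m a"
      using bij_betw_imp_surj_on[OF bij_betw_other_digit, of m] by blast
    have "int l ^ Suc m * int t \<le> z"
      using lpos[of "Suc m"] by (simp only: tz) (simp add: minus_mod_eq_mult_div[symmetric])
    also have "z < int l ^ (m + v)" by (rule z_bd)
    also have "m + v = Suc m + (v - 1)" using v_pos by simp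
    finally have "int t < int l ^ (v - 1)"
      using lpos[of "Suc m"] by (simp only: power_add mult_less_cancel_left_pos)
    then have "t < l ^ (v - 1)" by (metis of_nat_less_iff of_nat_power)
    then have t: "t \<in> {0..l ^ (v - 1) - 1}" by simp
    have "C i = c_fin q l n \<gamma> m a t i" for i
    proof -
      have "[z = y] (mod int l ^ min i (m + v))"
        using zy by (rule cong_dvd_modulus) (simp add: le_imp_power_dvd)
      then have "[\<gamma> + int n * z = \<gamma> + int n * y] (mod int l ^ min i (m + v))"
        by (simp add: cong_add_lcancel cong_scalar_left)
      then have "C i = cyc_coset q (l ^ i * n) (\<gamma> + int n * z)"
        unfolding Cy by (simp only: eq_iff)
      then show ?thesis
        by (simp only: c_fin_def cyc_U_eq z_eq d)
    qed
    then have "C = c_fin q l n \<gamma> m a t" by (rule ext)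
    with a t show thesis by (rule that(2))
  qed
qed

text \<open>The valuation recovers \<open>m\<close>; the coset at degree \<open>m + v\<close> then
  recovers the reduced representative, whose digits give \<open>a\<close> and
  \<open>t\<close>.\<close>

lemma c_fin_inj:
  assumes a: "a \<in> {1..l - 1}" "t \<in> {0..l ^ (v - 1) - 1}"
    and b: "b \<in> {1..l - 1}" "s \<in> {0..l ^ (v - 1) - 1}"
    and eq: "c_fin q l n \<gamma> m a t = c_fin q l n \<gamma> k b s"
  shows "m = k \<and> a = b \<and> t = s"
proof -
  let ?y = "cyc_U l n \<gamma> m a + int l ^ (m + 1) * int t"
  let ?z = "cyc_U l n \<gamma> k b + int l ^ (k + 1) * int s"
  have eq': "cyc_coset q (l ^ i * n) (\<gamma> + int n * ?y) = cyc_coset q (l ^ i * n) (\<gamma> + int n * ?z)" for i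
    using fun_cong[OF eq, of i] by (simp only: c_fin_def)
  note ym = lift_valuation[OF a(1), of m "int t"] and zk = lift_valuation[OF b(1), of k "int s"]
  have "\<not> m < k"
    using ym(2) zk(1) lift_dvd_cong[OF eq', of "Suc m" "Suc m"]
    by (meson Suc_leI dvd_trans le_imp_power_dvd order_refl)
  moreover have "\<not> k < m"
    using zk(2) ym(1) lift_dvd_cong[OF eq', of "Suc k" "Suc k"]
    by (meson Suc_leI dvd_trans le_imp_power_dvd order_refl)
  ultimately have mk: "m = k" by simp
  have "[\<gamma> + int n * ?z = \<gamma> + int n * ?y] (mod int l ^ min (m + v) (m + v))"
    using eq' level_coset_eq_iff_cong[OF lift_cong_base lift_cong_base ym] by blast
  then have "[?z = ?y] (mod int l ^ (m + v))"
    by (simp only: min.idem cong_add_lcancel cong_n_mult_cancel)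
  then have zy: "?z = ?y"
    using fin_rep_bounds[OF a, of m] fin_rep_bounds[OF b, of k] by (simp only: mk cong_def mod_pos_pos_trivial)
  have "?z mod int l ^ Suc m = ?y mod int l ^ Suc m" using zy by simp
  then have U: "cyc_U l n \<gamma> m b = cyc_U l n \<gamma> m a"
    using cyc_U_bounds[OF a(1), of m] cyc_U_bounds[OF b(1), of m]
    by (simp add: mk)
  then have "other_digit l n \<gamma> m b = other_digit l n \<gamma> m a"
    using l_gt_1 by (simp add: cyc_U_eq)
  then have "a = b"
    using bij_betw_imp_inj_on[OF bij_betw_other_digit, of m] a(1) b(1) by (metis inj_onD)
  moreover have "t = s" using zy U l_gt_1 by (simp add: mk)
  ultimately show ?thesis using mk by simp
qed

text \<open>At degree \<open>m + 1\<close> divisibility by \<open>l ^ Suc m\<close> separates the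
  two cosets.\<close>

lemma c_fin_neq_c_inf:
  assumes "a \<in> {1..l - 1}"
  shows "c_fin q l n \<gamma> m a t \<noteq> c_inf q l n \<gamma>"
proof
  assume "c_fin q l n \<gamma> m a t = c_inf q l n \<gamma>"
  then have "cyc_coset q (l ^ Suc m * n) (\<gamma> + int n * (cyc_U l n \<gamma> m a + int l ^ (m + 1) * int t)) =
      cyc_coset q (l ^ Suc m * n) (\<gamma> + int n * cyc_trunc l n \<gamma> (Suc m))"
    unfolding c_fin_def c_inf_def by (rule fun_cong)
  then have "int l ^ Suc m dvd \<gamma> + int n * (cyc_U l n \<gamma> m a + int l ^ (m + 1) * int t) \<longleftrightarrow>
      int l ^ Suc m dvd \<gamma> + int n * cyc_trunc l n \<gamma> (Suc m)"
    by (rule lift_dvd_cong) (rule order_refl)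
  then have "int l ^ Suc m dvd \<gamma> + int n * (cyc_U l n \<gamma> m a + int l ^ (m + 1) * int t)"
    by (simp only: dvd_lift_iff cong_refl)
  then show False using lift_valuation(2)[OF assms] by (rule notE[rotated])
qed

section \<open>Valuations and the splitting condition\<close>

lemma power_le_ladic_val_iff: "enat k \<le> ladic_val l x \<longleftrightarrow> int l ^ k dvd x"
proof (cases "x = 0")
  case False
  have "\<not> is_unit (int l)" using l_gt_1 by simp
  then show ?thesis
    using False by (simp add: ladic_val_def power_dvd_iff_le_multiplicity)
qed (simp add: ladic_val_def)

lemma ladic_val_eq_enat_iff:
  "ladic_val l x = enat k \<longleftrightarrow> int l ^ k dvd x \<and> \<not> int l ^ Suc k dvd x"
  unfolding power_le_ladic_val_iff[symmetric]
  by (cases "ladic_val l x") auto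

lemma ladic_val_level: "ladic_val l (int (l ^ i * n)) = enat i"
  using l_n l_gt_1 by (simp add: ladic_val_eq_enat_iff)

lemma ladic_val_Q: "ladic_val l (int q ^ \<tau> - 1) = enat v"
  using l_c l_gt_1 by (simp add: ladic_val_eq_enat_iff Q_eq)

text \<open>The representative at degree \<open>i\<close> is divisible by \<open>l ^ i\<close>, so
  the coset size stays \<tau>, and \<open>v\<close> supplies the additional 1 in the
  inequality.\<close>

lemma c_inf_splitting: "splitting_seq q l n (c_inf q l n \<gamma>)"
  unfolding splitting_seq_def splitting_at_def splitting_coset_def
proof (intro allI)
  fix i
  let ?x = "\<gamma> + int n * cyc_trunc l n \<gamma> i"
  have x: "int l ^ i dvd ?x" by (simp add: dvd_lift_iff)
  then have card: "card (c_inf q l n \<gamma> i) = \<tau>"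
    unfolding c_inf_def by (intro card_level_coset lift_cong_base) simp
  have "enat i + 1 \<le> ladic_val l ?x + enat v"
    using x v_pos unfolding power_le_ladic_val_iff[symmetric]
    by (intro add_mono) (simp_all add: one_enat_def)
  moreover have "int l dvd int q ^ \<tau> - 1" using v_pos by (simp add: Q_eq)
  ultimately show "int l dvd int q ^ card (c_inf q l n \<gamma> i) - 1 \<and>
      (\<exists>\<delta>. c_inf q l n \<gamma> i = cyc_coset q (l ^ i * n) \<delta> \<and>
        ladic_val l (int (l ^ i * n)) + 1 \<le> ladic_val l \<delta> + ladic_val l (int q ^ card (c_inf q l n \<gamma> i) - 1))"
    unfolding card ladic_val_Q ladic_val_level by (auto simp: c_inf_def)
qed

text \<open>The obstruction sits at degree \<open>m + v\<close>, the last one at which the coset still has size \<open>\<tau>\<close>.\<close>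

lemma c_fin_not_splitting:
  assumes "a \<in> {1..l - 1}"
  shows "\<not> splitting_seq q l n (c_fin q l n \<gamma> m a t)"
proof
  let ?i = "m + v"
  let ?x = "\<gamma> + int n * (cyc_U l n \<gamma> m a + int l ^ (m + 1) * int t)"
  note val = lift_valuation[OF assms, of m "int t"]
  assume "splitting_seq q l n (c_fin q l n \<gamma> m a t)"
  then obtain \<delta> where \<delta>: "c_fin q l n \<gamma> m a t ?i = cyc_coset q (l ^ ?i * n) \<delta>"
    and le: "ladic_val l (int (l ^ ?i * n)) + 1 \<le>
      ladic_val l \<delta> + ladic_val l (int q ^ card (c_fin q l n \<gamma> m a t ?i) - 1)"
    unfolding splitting_seq_def splitting_at_def splitting_coset_def by blast
  have "int l ^ ?i dvd ?x * (int q ^ \<tau> - 1)"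
    using val(1) by (simp add: Q_eq power_add mult_dvd_mono)
  then have card: "card (c_fin q l n \<gamma> m a t ?i) = \<tau>"
    unfolding c_fin_def by (intro card_level_coset lift_cong_base)
  \<comment> \<open>Splitting may be witnessed by any representative \<delta>. Being
    \<open>?x\<close> times a power of \<open>q\<close> modulo \<open>l ^ (m + v)\<close>, it too is
    not divisible by \<open>l ^ Suc m\<close>, whereas the inequality asks for valuation at least
    \<open>m + 1\<close>.\<close>
  obtain j where "[\<delta> = ?x * int q ^ j] (mod int (l ^ ?i * n))"
    using \<delta> unfolding c_fin_def cyc_coset_eq_iff[OF coprime_q_level level_pos] by blast
  then have "[\<delta> = ?x * int q ^ j] (mod int l ^ ?i)" by (simp only: cong_level_iff)
  then have "[\<delta> = ?x * int q ^ j] (mod int l ^ Suc m)"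
    using v_pos by (elim cong_dvd_modulus) (intro le_imp_power_dvd, simp)
  then have "int l ^ Suc m dvd \<delta> \<longleftrightarrow> int l ^ Suc m dvd ?x * int q ^ j" by (rule cong_dvd_iff)
  also have "\<dots> \<longleftrightarrow> int l ^ Suc m dvd ?x"
  proof (rule coprime_dvd_mult_left_iff)
    show "coprime (int l ^ Suc m) (int q ^ j)"
      using coprime_q_l by (simp add: coprime_commute)
  qed
  finally have "\<not> enat (Suc m) \<le> ladic_val l \<delta>"
    using val(2) by (simp only: power_le_ladic_val_iff not_False_eq_True)
  then show False
    using le unfolding card ladic_val_Q ladic_val_level
    by (cases "ladic_val l \<delta>") (auto simp: one_enat_def)
qed

end

theorem theorem5p1:
  fixes p e q l n \<tau> v :: nat and \<gamma> :: int
  assumes "prime p" and "e \<ge> 1" and "q = p ^ e"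
    and "prime l" and "odd l" and "l \<noteq> p"
    and "n > 0" and "\<not> p dvd n" and "\<not> l dvd n"
    and "\<tau> = card (cyc_coset q n \<gamma>)"
    and "int l dvd int q ^ \<tau> - 1"
    and "enat v = ladic_val l (int q ^ \<tau> - 1)"
  shows
    "(c_inf q l n \<gamma> \<in> cyc_system q l n \<gamma> \<and>
      splitting_seq q l n (c_inf q l n \<gamma>) \<and>
      (\<forall>C \<in> cyc_system q l n \<gamma>. splitting_seq q l n C \<longrightarrow> C = c_inf q l n \<gamma>)) \<and>
     (\<forall>m. \<forall>a \<in> {1..l - 1}.
        (\<forall>t \<in> {0..l ^ (v - 1) - 1}. c_fin q l n \<gamma> m a t \<in> cyc_system q l n \<gamma>) \<and>
        card (c_fin q l n \<gamma> m a ` {0..l ^ (v - 1) - 1}) = l ^ (v - 1)) \<and>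
     cyc_system q l n \<gamma> =
       insert (c_inf q l n \<gamma>)
         {c_fin q l n \<gamma> m a t | m a t. a \<in> {1..l - 1} \<and> t \<in> {0..l ^ (v - 1) - 1}} \<and>
     inj_on (\<lambda>(m, a, t). c_fin q l n \<gamma> m a t) (UNIV \<times> {1..l - 1} \<times> {0..l ^ (v - 1) - 1}) \<and>
     (\<forall>m. \<forall>a \<in> {1..l - 1}. \<forall>t \<in> {0..l ^ (v - 1) - 1}. c_fin q l n \<gamma> m a t \<noteq> c_inf q l n \<gamma>)"
proof -
  have "coprime p n" "coprime p l"
    using \<open>prime p\<close> \<open>\<not> p dvd n\<close> \<open>prime l\<close> \<open>l \<noteq> p\<close> by (auto simp: prime_imp_coprime primes_coprime)
  then have cop: "coprime q n" "coprime q l"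
    by (simp_all add: \<open>q = p ^ e\<close>)
  have \<tau>: "\<tau> = coset_period q n \<gamma>"
    using \<open>\<tau> = card _\<close> card_cyc_coset[OF cop(1) \<open>n > 0\<close>] by simp
  \<comment> \<open>The value 0 would have infinite valuation, which no \<open>enat v\<close>
    equals.\<close>
  have ne: "int q ^ \<tau> - 1 \<noteq> 0" and v: "v = multiplicity (int l) (int q ^ \<tau> - 1)"
    using \<open>enat v = _\<close> by (auto simp: ladic_val_def split: if_splits)
  have not_unit: "\<not> is_unit (int l)"
    using prime_gt_1_nat[OF \<open>prime l\<close>] by simp
  obtain c where c: "int q ^ \<tau> - 1 = int l ^ v * c" "\<not> int l dvd c"
    using multiplicity_decompose'[OF ne not_unit] unfolding v by blast
  have "v \<ge> 1"
    using \<open>int l dvd int q ^ \<tau> - 1\<close> ne not_unit by (simp add: v multiplicity_geI)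
  interpret cyc_tower q l n \<tau> v \<gamma> c
  proof
    show "int q ^ \<tau> = 1 + int l ^ v * c" using c(1) by simp
  qed fact+
  have inj: "inj_on (\<lambda>(m, a, t). c_fin q l n \<gamma> m a t) (UNIV \<times> {1..l - 1} \<times> {0..l ^ (v - 1) - 1})"
  proof (rule inj_onI)
    fix x y
    assume *: "x \<in> UNIV \<times> {1..l - 1} \<times> {0..l ^ (v - 1) - 1}"
      "y \<in> UNIV \<times> {1..l - 1} \<times> {0..l ^ (v - 1) - 1}"
      "(\<lambda>(m, a, t). c_fin q l n \<gamma> m a t) x = (\<lambda>(m, a, t). c_fin q l n \<gamma> m a t) y"
    obtain m a t k b s where xy: "x = (m, a, t)" "y = (k, b, s)"
      by (metis prod_cases3)
    have "m = k \<and> a = b \<and> t = s"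
      by (rule c_fin_inj) (use * xy in simp_all)
    then show "x = y" by (simp add: xy)
  qed
  have card: "card (c_fin q l n \<gamma> m a ` {0..l ^ (v - 1) - 1}) = l ^ (v - 1)"
    if "a \<in> {1..l - 1}" for m a
  proof -
    have "inj_on (c_fin q l n \<gamma> m a) {0..l ^ (v - 1) - 1}"
      by (rule inj_onI) (use c_fin_inj[OF that _ that] in blast)
    moreover have "0 < l ^ (v - 1)" using l_gt_1 by simp
    ultimately show ?thesis by (simp add: card_image)
  qed
  \<comment> \<open>Uniqueness follows from the classification, since every \<open>c_fin\<close>
    sequence fails to split.\<close>
  have unique: "C = c_inf q l n \<gamma>" if "C \<in> cyc_system q l n \<gamma>" "splitting_seq q l n C" for C
    using that(1)
  proof (cases rule: system_cases)
    case (2 m a t)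
    then show ?thesis using that(2) c_fin_not_splitting by blast
  qed
  have all: "cyc_system q l n \<gamma> = insert (c_inf q l n \<gamma>)
      {c_fin q l n \<gamma> m a t | m a t. a \<in> {1..l - 1} \<and> t \<in> {0..l ^ (v - 1) - 1}}"
  proof
    show "cyc_system q l n \<gamma> \<subseteq> insert (c_inf q l n \<gamma>)
        {c_fin q l n \<gamma> m a t | m a t. a \<in> {1..l - 1} \<and> t \<in> {0..l ^ (v - 1) - 1}}"
    proof
      fix C assume "C \<in> cyc_system q l n \<gamma>"
      then show "C \<in> insert (c_inf q l n \<gamma>)
          {c_fin q l n \<gamma> m a t | m a t. a \<in> {1..l - 1} \<and> t \<in> {0..l ^ (v - 1) - 1}}"
        by (rule system_cases) blast+
    qed
  qed (use c_inf_system c_fin_system in blast)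
  show ?thesis
    by (intro conjI allI ballI impI c_inf_system c_inf_splitting c_fin_system c_fin_neq_c_inf)
      (fact unique card inj all)+
qed

end
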